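(* There are type $A$ crystal poset intervals with arbitrarily large Möbius function: for every integer $N$ there exist $n$, a partition $\lambda$, and elements $u\le v$ of the type $A_{n-1}$ crystal poset $B(\lambda)$ with $\mu(u,v)\ge N$.
   Context: The type $A_{n-1}$ crystal poset $B(\lambda)$ is the set of semistandard Young tableaux of shape $\lambda$ with entries in $\{1,\dots,n\}$, partially ordered by the transitive closure of $T\lessdot f_i(T)$, where $f_i$ is the crystal operator given by the signature rule: read the entries $i$ and $i+1$ of $T$ column by column from left to right, bottom to top within a column, write $+$ for $i$ and $-$ for $i+1$, repeatedly cancel adjacent pairs $-+$ to obtain $+^x-^y$; if $x>0$, $f_i(T)$ changes the $i$ corresponding to the rightmost uncancelled $+$ into $i+1$ (otherwise $f_i(T)=\mathbf 0$). $\mu$ denotes the Möbius function of this poset. *)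

theory Defs
  imports Main
begin

section \<open>The Moebius function of a locally finite poset\<close>

text \<open>
  A poset is a relation \<open>r\<close> that is a partial order on its field. The value is 0 for pairs
  that are not comparable, and by convention also when \<open>r\<close> is not a partial order or the
  interval is infinite; these guards only serve to make the recursion terminate.
\<close>

definition interval :: "'a rel \<Rightarrow> 'a \<Rightarrow> 'a \<Rightarrow> 'a set" where
  "interval r x y = {z. (x, z) \<in> r \<and> (z, y) \<in> r}"

function mobius :: "'a rel \<Rightarrow> 'a \<Rightarrow> 'a \<Rightarrow> int" where
  "mobius r x y =
     (if Partial_order r \<and> finite (interval r x y) \<and> (x, y) \<in> r
      then if x = y then 1 else - (\<Sum>z \<in> interval r x y - {y}. mobius r x z)
      else 0)"
  by pat_completeness auto
termination
proof (relation "measure (\<lambda>(r, x, y). card (interval r x y))", goal_cases)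
  case (2 r x y z)
  then have po: "Partial_order r" and fin: "finite (interval r x y)" and xy: "(x, y) \<in> r"
    and zy: "(z, y) \<in> r" "z \<noteq> y" by (auto simp: interval_def)
  from po have "trans r" "antisym r" "(y, y) \<in> r"
    using xy by (auto simp: partial_order_on_def preorder_on_def refl_on_def Field_def)
  then have "interval r x z \<subset> interval r x y"
    using zy xy by (auto simp: interval_def dest: transD antisymD)
  with fin show ?case by (simp add: psubset_card_mono)
qed auto

declare mobius.simps [simp del]

section \<open>Partitions and semistandard Young tableaux\<close>

definition is_partition :: "nat list \<Rightarrow> bool" where
  "is_partition lam \<longleftrightarrow> sorted_wrt (\<ge>) lam \<and> 0 \<notin> set lam"

text \<open>
  Cells are (row, column), counted from 0, in English notation: row 0 is the top row.
  A tableau is a filling of the cells that is 0 off the diagram, so that two tableaux of the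
  same shape are equal iff their entries agree.
\<close>

type_synonym cell = "nat \<times> nat"
type_synonym tableau = "cell \<Rightarrow> nat"

definition diagram :: "nat list \<Rightarrow> cell set" where
  "diagram lam = {(r, c). r < length lam \<and> c < lam ! r}"

definition ssyt :: "nat \<Rightarrow> nat list \<Rightarrow> tableau set" where
  "ssyt n lam =
     {T. (\<forall>x. x \<notin> diagram lam \<longrightarrow> T x = 0) \<and>
         (\<forall>x \<in> diagram lam. T x \<in> {1..n}) \<and>
         (\<forall>r c c'. c < c' \<and> (r, c) \<in> diagram lam \<and> (r, c') \<in> diagram lam
            \<longrightarrow> T (r, c) \<le> T (r, c')) \<and>
         (\<forall>r r' c. r < r' \<and> (r, c) \<in> diagram lam \<and> (r', c) \<in> diagram lam
            \<longrightarrow> T (r, c) < T (r', c))}"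

section \<open>Crystal operators by the signature rule\<close>

text \<open>Columns from left to right, each column from bottom to top.\<close>

definition reading_cells :: "nat list \<Rightarrow> cell list" where
  "reading_cells lam =
     concat (map (\<lambda>c. filter (\<lambda>x. x \<in> diagram lam) (map (\<lambda>r. (r, c)) (rev [0..<length lam])))
                 [0..<Max (set (0 # lam))])"

datatype sign = Plus | Minus

text \<open>Each sign remembers the cell it comes from.\<close>

definition signature :: "nat list \<Rightarrow> nat \<Rightarrow> tableau \<Rightarrow> (sign \<times> cell) list" where
  "signature lam i T =
     map (\<lambda>x. (if T x = i then Plus else Minus, x))
         (filter (\<lambda>x. T x = i \<or> T x = Suc i) (reading_cells lam))"

text \<open>
  A single cancellation of an adjacent pair \<open>-+\<close>, and a function computing the result of
  cancelling as long as possible; \<open>cancel_eq_iff\<close> below relates the two.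
\<close>

inductive cancel_step :: "(sign \<times> 'c) list \<Rightarrow> (sign \<times> 'c) list \<Rightarrow> bool" where
  "cancel_step (us @ (Minus, a) # (Plus, b) # vs) (us @ vs)"

fun cancel_cons :: "sign \<times> 'c \<Rightarrow> (sign \<times> 'c) list \<Rightarrow> (sign \<times> 'c) list" where
  "cancel_cons (Minus, a) ((Plus, b) # w) = w"
| "cancel_cons p w = p # w"

definition cancel :: "(sign \<times> 'c) list \<Rightarrow> (sign \<times> 'c) list" where
  "cancel w = foldr cancel_cons w []"

lemma cancel_step_Cons: "cancel_step v w \<Longrightarrow> cancel_step (p # v) (p # w)"
  by (metis append_Cons cancel_step.simps)

lemma cancel_steps_Cons: "cancel_step\<^sup>*\<^sup>* v w \<Longrightarrow> cancel_step\<^sup>*\<^sup>* (p # v) (p # w)"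
  by (induction rule: rtranclp_induct) (auto intro: cancel_step_Cons rtranclp.rtrancl_into_rtrancl)

lemma cancel_cons_steps: "cancel_step\<^sup>*\<^sup>* (p # w) (cancel_cons p w)"
  by (cases "(p, w)" rule: cancel_cons.cases)
    (auto intro: r_into_rtranclp cancel_step.intros[of "[]", simplified])

lemma cancel_steps: "cancel_step\<^sup>*\<^sup>* w (cancel w)"
proof (induction w)
  case (Cons p w)
  have "cancel_step\<^sup>*\<^sup>* (p # w) (p # cancel w)"
    by (rule cancel_steps_Cons[OF Cons.IH])
  also have "cancel_step\<^sup>*\<^sup>* (p # cancel w) (cancel_cons p (cancel w))"
    by (rule cancel_cons_steps)
  finally show ?case by (simp add: cancel_def)
qed (simp add: cancel_def)

text \<open>The result has the form \<open>+^x -^y\<close>.\<close>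

lemma cancel_form:
  "\<exists>us vs. cancel w = map (Pair Plus) us @ map (Pair Minus) vs"
proof (induction w)
  case (Cons p w)
  then obtain us vs where w: "cancel w = map (Pair Plus) us @ map (Pair Minus) vs" by blast
  obtain s a where p: "p = (s, a)" by fastforce
  have c: "cancel (p # w) = cancel_cons p (cancel w)" by (simp add: cancel_def)
  show ?case
  proof (cases s)
    case Plus
    then have "cancel (p # w) = map (Pair Plus) (a # us) @ map (Pair Minus) vs"
      using c w p by simp
    then show ?thesis by blast
  next
    case Minus
    show ?thesis
    proof (cases us)
      case Nil
      then have "cancel (p # w) = map (Pair Plus) [] @ map (Pair Minus) (a # vs)"
        using c w p Minus by (cases vs) auto
      then show ?thesis by blast
    next
      case (Cons u us')
      then have "cancel (p # w) = map (Pair Plus) us' @ map (Pair Minus) vs"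
        using c w p Minus by simp
      then show ?thesis by blast
    qed
  qed
qed (auto simp: cancel_def)

lemma cancel_step_invariant: "cancel_step v w \<Longrightarrow> cancel v = cancel w"
proof (induction rule: cancel_step.induct)
  case (1 us a b vs)
  obtain xs ys where "cancel vs = map (Pair Plus) xs @ map (Pair Minus) ys"
    using cancel_form by blast
  then show ?case by (simp add: cancel_def)
qed

lemma cancel_fixed:
  assumes "\<nexists>v. cancel_step w v"
  shows "cancel w = w"
  using cancel_steps[of w] assms by (metis converse_rtranclpE)

lemma cancel_irreducible: "\<not> cancel_step (cancel w) v"
proof
  assume "cancel_step (cancel w) v"
  then obtain us a b vs where e: "cancel w = us @ (Minus, a) # (Plus, b) # vs"
    by (auto elim: cancel_step.cases)
  obtain xs ys where "cancel w = map (Pair Plus) xs @ map (Pair Minus) ys"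
    using cancel_form by blast
  with e show False
    by (auto simp: append_eq_append_conv2 append_eq_Cons_conv Cons_eq_append_conv map_eq_append_conv
        map_eq_Cons_conv)
qed

lemma cancel_eq_iff:
  "cancel w = v \<longleftrightarrow> cancel_step\<^sup>*\<^sup>* w v \<and> (\<nexists>v'. cancel_step v v')"
proof
  assume "cancel_step\<^sup>*\<^sup>* w v \<and> (\<nexists>v'. cancel_step v v')"
  moreover have "cancel w = cancel v" if "cancel_step\<^sup>*\<^sup>* w v"
    using that by induction (auto dest: cancel_step_invariant)
  ultimately show "cancel w = v" using cancel_fixed by metis
qed (use cancel_steps cancel_irreducible in auto)

text \<open>\<open>None\<close> stands for the element \<open>0\<close> outside the crystal.\<close>

definition crystal_f :: "nat list \<Rightarrow> nat \<Rightarrow> tableau \<Rightarrow> tableau option" where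
  "crystal_f lam i T =
     (let ps = [x. (s, x) \<leftarrow> cancel (signature lam i T), s = Plus]
      in if ps = [] then None else Some (T(last ps := Suc i)))"

section \<open>The crystal poset of type A\<close>

definition crystal_step :: "nat \<Rightarrow> nat list \<Rightarrow> tableau rel" where
  "crystal_step n lam =
     {(S, T). S \<in> ssyt n lam \<and> (\<exists>i \<in> {1..<n}. crystal_f lam i S = Some T)}"

definition crystal_order :: "nat \<Rightarrow> nat list \<Rightarrow> tableau rel" where
  "crystal_order n lam = Restr ((crystal_step n lam)\<^sup>*) (ssyt n lam)"

text \<open>
  The crystal order is a finite partial order with carrier \<open>ssyt n lam\<close>, so that the guards
  in the definition of \<open>mobius\<close> are always met.
\<close>

lemma finite_diagram: "finite (diagram lam)"
proof -
  have "diagram lam = Sigma {..<length lam} (\<lambda>r. {..<lam ! r})"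
    by (auto simp: diagram_def)
  then show ?thesis by simp
qed

lemma finite_ssyt: "finite (ssyt n lam)"
proof (rule finite_subset)
  show "ssyt n lam \<subseteq> {T. \<forall>x. (x \<in> diagram lam \<longrightarrow> T x \<in> {1..n}) \<and> (x \<notin> diagram lam \<longrightarrow> T x = 0)}"
    by (auto simp: ssyt_def)
  show "finite \<dots>"
    by (rule finite_set_of_finite_funs) (auto simp: finite_diagram)
qed

lemma cancel_subset: "set (cancel w) \<subseteq> set w"
proof -
  have step: "set v' \<subseteq> set v" if "cancel_step v v'" for v v' :: "(sign \<times> 'a) list"
    using that by cases auto
  have "set v' \<subseteq> set v" if "cancel_step\<^sup>*\<^sup>* v v'" for v v' :: "(sign \<times> 'a) list"
    using that by (induction rule: rtranclp_induct) (use step in blast)+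
  then show ?thesis using cancel_steps by blast
qed

lemma crystal_f_SomeE:
  assumes "crystal_f lam i S = Some T"
  obtains x where "x \<in> diagram lam" "S x = i" "T = S(x := Suc i)"
proof -
  define ps where "ps = [x. (s, x) \<leftarrow> cancel (signature lam i S), s = Plus]"
  have ne: "ps \<noteq> []" and T: "T = S(last ps := Suc i)"
    using assms by (auto simp: crystal_f_def ps_def Let_def split: if_splits)
  have "(Plus, last ps) \<in> set (cancel (signature lam i S))"
    using last_in_set[OF ne] by (auto simp: ps_def split: if_splits)
  then have "(Plus, last ps) \<in> set (signature lam i S)"
    using cancel_subset by blast
  then have "last ps \<in> diagram lam" "S (last ps) = i"
    by (auto simp: signature_def reading_cells_def split: if_splits)
  with T that show thesis by blast
qed

lemma crystal_step_sum:
  assumes "(S, T) \<in> crystal_step n lam"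
  shows "sum S (diagram lam) < sum T (diagram lam)"
proof -
  obtain i where "crystal_f lam i S = Some T"
    using assms by (auto simp: crystal_step_def)
  then obtain x where "x \<in> diagram lam" "S x = i" "T = S(x := Suc i)"
    by (rule crystal_f_SomeE)
  then show ?thesis
    by (intro sum_strict_mono_ex1 finite_diagram) auto
qed

lemma crystal_steps_sum:
  assumes "(S, T) \<in> (crystal_step n lam)\<^sup>*"
  shows "S = T \<or> sum S (diagram lam) < sum T (diagram lam)"
  using assms by induction (auto dest: crystal_step_sum)

lemma Field_crystal_order: "Field (crystal_order n lam) = ssyt n lam"
  by (auto simp: crystal_order_def Field_def)

lemma Partial_order_crystal_order: "Partial_order (crystal_order n lam)"
  unfolding Field_crystal_order partial_order_on_def preorder_on_def
proof (intro conjI)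
  show "refl_on (ssyt n lam) (crystal_order n lam)"
    by (auto simp: refl_on_def crystal_order_def)
  show "trans (crystal_order n lam)"
    by (auto simp: crystal_order_def intro!: transI)
  show "antisym (crystal_order n lam)"
    by (rule antisymI) (auto simp: crystal_order_def dest!: crystal_steps_sum)
qed (auto simp: crystal_order_def)

lemma finite_interval_crystal_order: "finite (interval (crystal_order n lam) u v)"
  by (rule finite_subset[OF _ finite_ssyt[of n lam]]) (auto simp: interval_def crystal_order_def)

end

theory Submission
  imports Defs
begin

text \<open>
  In the crystal of shape (3,3) with entries up to 4, consider the interval between 112/234 and
  123/344. Its lower end is covered by three elements, and every element strictly inside lies above
  exactly one of them. Hence the open interval falls into three disjoint cones, and the Moebius
  function is 3 - 1 = 2. Two tableaux can be stacked, the letters of the lower one being shifted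
  beyond those of the upper one. As long as no letter crosses from the upper alphabet to the lower
  one, the two parts evolve independently, so intervals between stacked tableaux are products and
  Moebius functions multiply. Stacking copies of the interval above yields all powers of 2.
\<close>

section \<open>Moebius functions of products and of disjoint cones\<close>

lemma interval_mono: "trans r \<Longrightarrow> (z, y) \<in> r \<Longrightarrow> interval r x z \<subseteq> interval r x y"
  by (auto simp: interval_def dest: transD)

lemma interval_refl:
  assumes "Partial_order r" "(x, x) \<in> r"
  shows "interval r x x = {x}"
  using assms by (auto simp: interval_def dest: partial_order_onD(3) antisymD)

lemma interval_endpoints:
  assumes "Partial_order r" "(x, y) \<in> r"
  shows "x \<in> interval r x y" "y \<in> interval r x y"
  using assms partial_order_onD(1)[OF assms(1)] by (auto simp: interval_def refl_on_def Field_def)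

lemma interval_subinterval:
  assumes "Partial_order r" "z \<in> interval r x y"
  shows "interval r x z \<subseteq> interval r x y"
  using assms(2)
  by (intro interval_mono[OF partial_order_onD(2)[OF assms(1)]]) (simp add: interval_def)

lemma sum_mobius_interval:
  assumes "Partial_order r" "finite (interval r x y)" "(x, y) \<in> r"
  shows "(\<Sum>z\<in>interval r x y. mobius r x z) = (if y = x then 1 else 0)"
  using assms interval_endpoints[of r x y]
  by (subst sum.remove[of _ y]) (auto simp: mobius.simps[of r x y] interval_refl)

lemma mobius_unique:
  assumes "Partial_order r" "finite (interval r x y)" "(x, y) \<in> r"
    and "\<And>z. z \<in> interval r x y \<Longrightarrow> (\<Sum>w\<in>interval r x z. g w) = (if z = x then 1 else 0)"
  shows "mobius r x y = g y"
  using assms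
proof (induction r x y rule: mobius.induct)
  case (1 r x y)
  have y: "y \<in> interval r x y"
    using "1.prems" by (intro interval_endpoints)
  show ?case
  proof (cases "x = y")
    case True
    then show ?thesis
      using "1.prems"(1,3) "1.prems"(4)[OF y] by (simp add: mobius.simps[of r y y] interval_refl)
  next
    case False
    have "mobius r x z = g z" if z: "z \<in> interval r x y - {y}" for z
    proof (rule "1.IH")
      have "interval r x z \<subseteq> interval r x y"
        using "1.prems"(1) z by (intro interval_subinterval) auto
      then show "finite (interval r x z)"
        "\<And>w. w \<in> interval r x z \<Longrightarrow> (\<Sum>v\<in>interval r x w. g v) = (if w = x then 1 else 0)"
        using "1.prems" by (auto intro: finite_subset)
    qed (use "1.prems"(1-3) z False in \<open>auto simp: interval_def\<close>)
    then have "mobius r x y = - (\<Sum>z\<in>interval r x y - {y}. g z)"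
      using "1.prems" False by (simp add: mobius.simps[of r x y])
    also have "\<dots> = g y"
      using "1.prems"(2) "1.prems"(4)[OF y] y False by (simp add: sum.remove)
    finally show ?thesis .
  qed
qed

lemma inj_on_order_embedding:
  assumes r: "Partial_order r" and "X \<subseteq> Field r"
    and embed: "\<And>a b. a \<in> X \<Longrightarrow> b \<in> X \<Longrightarrow> (\<phi> a, \<phi> b) \<in> s \<longleftrightarrow> (a, b) \<in> r"
  shows "inj_on \<phi> X"
proof (rule inj_onI)
  fix a b
  assume ab: "a \<in> X" "b \<in> X" "\<phi> a = \<phi> b"
  have "(a, a) \<in> r"
    using partial_order_onD(1)[OF r] ab(1) \<open>X \<subseteq> Field r\<close> by (auto simp: refl_on_def)
  then have "(a, b) \<in> r" "(b, a) \<in> r"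
    using embed ab by metis+
  then show "a = b"
    using antisymD[OF partial_order_onD(3)[OF r]] by blast
qed

lemma interval_order_embedding:
  assumes s: "Partial_order s" and sub: "interval r x z \<subseteq> X" and "x \<in> X" "z \<in> X"
    and embed: "\<And>a b. a \<in> X \<Longrightarrow> b \<in> X \<Longrightarrow> (\<phi> a, \<phi> b) \<in> s \<longleftrightarrow> (a, b) \<in> r"
    and convex: "interval s (\<phi> x) (\<phi> y) \<subseteq> \<phi> ` X" and le: "(\<phi> z, \<phi> y) \<in> s"
  shows "interval s (\<phi> x) (\<phi> z) = \<phi> ` interval r x z"
proof -
  have "\<phi> w \<in> interval s (\<phi> x) (\<phi> z) \<longleftrightarrow> w \<in> interval r x z" if "w \<in> X" for w
    using embed \<open>x \<in> X\<close> \<open>z \<in> X\<close> that by (simp add: interval_def)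
  moreover have "interval s (\<phi> x) (\<phi> z) \<subseteq> \<phi> ` X"
    using interval_mono[OF partial_order_onD(2)[OF s] le] convex by blast
  ultimately show ?thesis
    using sub by blast
qed

lemma mobius_order_embedding:
  assumes r: "Partial_order r" "finite (interval r x y)" "(x, y) \<in> r" and s: "Partial_order s"
    and embed: "\<And>a b. a \<in> interval r x y \<Longrightarrow> b \<in> interval r x y \<Longrightarrow> (\<phi> a, \<phi> b) \<in> s \<longleftrightarrow> (a, b) \<in> r"
    and convex: "interval s (\<phi> x) (\<phi> y) \<subseteq> \<phi> ` interval r x y"
  shows "mobius s (\<phi> x) (\<phi> y) = mobius r x y"
proof -
  have ends: "x \<in> interval r x y" "y \<in> interval r x y"
    using r by (auto intro: interval_endpoints)
  have inj: "inj_on \<phi> (interval r x y)"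
    using r(1) _ embed by (rule inj_on_order_embedding) (auto simp: interval_def Field_def)
  have "mobius r x y = (mobius s (\<phi> x) \<circ> \<phi>) y"
  proof (rule mobius_unique[OF r])
    fix z assume z: "z \<in> interval r x y"
    have sub: "interval r x z \<subseteq> interval r x y"
      using r z by (intro interval_subinterval)
    have le: "(\<phi> x, \<phi> z) \<in> s" "(\<phi> z, \<phi> y) \<in> s"
      using embed ends z by (auto simp: interval_def)
    have image: "interval s (\<phi> x) (\<phi> z) = \<phi> ` interval r x z"
      using s sub ends(1) z embed convex le(2) by (rule interval_order_embedding)
    have "(\<Sum>w\<in>interval r x z. (mobius s (\<phi> x) \<circ> \<phi>) w) =
        (\<Sum>v\<in>interval s (\<phi> x) (\<phi> z). mobius s (\<phi> x) v)"
      unfolding image by (rule sum.reindex[OF inj_on_subset[OF inj sub], symmetric])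
    also have "\<dots> = (if \<phi> z = \<phi> x then 1 else 0)"
      using s le(1) r(2) sub image by (intro sum_mobius_interval) (auto intro: finite_subset)
    also have "\<phi> z = \<phi> x \<longleftrightarrow> z = x"
      using inj_on_eq_iff[OF inj z ends(1)] .
    finally show "(\<Sum>w\<in>interval r x z. (mobius s (\<phi> x) \<circ> \<phi>) w) = (if z = x then 1 else 0)" .
  qed
  then show ?thesis by simp
qed

definition product_order :: "'a rel \<Rightarrow> 'b rel \<Rightarrow> ('a \<times> 'b) rel" where
  "product_order r s = {((a, b), (c, d)). (a, c) \<in> r \<and> (b, d) \<in> s}"

lemma interval_product_order:
  "interval (product_order r s) (a, b) (c, d) = interval r a c \<times> interval s b d"
  by (auto simp: interval_def product_order_def)

lemma Partial_order_product_order: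
  assumes "Partial_order r" "Partial_order s"
  shows "Partial_order (product_order r s)"
  unfolding partial_order_on_def preorder_on_def
proof (intro conjI)
  show "refl_on (Field (product_order r s)) (product_order r s)"
    using assms[THEN partial_order_onD(1)]
    by (fastforce simp: refl_on_def Field_def product_order_def)
  show "trans (product_order r s)"
    using assms[THEN partial_order_onD(2)]
    by (auto simp: product_order_def intro!: transI dest: transD)
  show "antisym (product_order r s)"
    using assms[THEN partial_order_onD(3)]
    by (auto simp: product_order_def intro!: antisymI dest: antisymD)
qed (auto simp: Field_def)

lemma mobius_product_order:
  assumes r: "Partial_order r" "finite (interval r x1 y1)" "(x1, y1) \<in> r"
    and s: "Partial_order s" "finite (interval s x2 y2)" "(x2, y2) \<in> s"
  shows "mobius (product_order r s) (x1, x2) (y1, y2) = mobius r x1 y1 * mobius s x2 y2"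
proof -
  let ?g = "\<lambda>(z1, z2). mobius r x1 z1 * mobius s x2 z2"
  have "mobius (product_order r s) (x1, x2) (y1, y2) = ?g (y1, y2)"
  proof (rule mobius_unique)
    show "Partial_order (product_order r s)"
      using r s by (intro Partial_order_product_order)
    show "((x1, x2), (y1, y2)) \<in> product_order r s"
      using r s by (simp add: product_order_def)
    show "finite (interval (product_order r s) (x1, x2) (y1, y2))"
      using r s by (simp add: interval_product_order)
    fix z assume "z \<in> interval (product_order r s) (x1, x2) (y1, y2)"
    then obtain z1 z2 where z: "z = (z1, z2)" "z1 \<in> interval r x1 y1" "z2 \<in> interval s x2 y2"
      by (auto simp: interval_product_order)
    have "finite (interval r x1 z1)" "finite (interval s x2 z2)"
      using interval_subinterval r s z by (metis finite_subset)+
    moreover have "(x1, z1) \<in> r" "(x2, z2) \<in> s"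
      using z by (auto simp: interval_def)
    ultimately show "(\<Sum>w\<in>interval (product_order r s) (x1, x2) z. ?g w) =
        (if z = (x1, x2) then 1 else 0)"
      using r(1) s(1)
      by (simp add: z(1) interval_product_order sum.cartesian_product[symmetric]
          sum_product[symmetric] sum_mobius_interval)
  qed
  then show ?thesis by simp
qed

lemma card_unique_below:
  assumes r: "Partial_order r" and A: "A \<subseteq> interval r x y - {x, y}"
    and unique: "\<And>z. z \<in> interval r x y - {x, y} \<Longrightarrow> \<exists>!a. a \<in> A \<and> (a, z) \<in> r"
    and z: "z \<in> interval r x y"
  shows "card (interval r x z \<inter> A) = (if z = x then 0 else if z = y then card A else 1)"
proof -
  have "interval r x z \<inter> A = {}" if "z = x"
    using that interval_refl[OF r] z A by (auto simp: interval_def)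
  moreover have "interval r x z \<inter> A = A" if "z = y"
    using that A by auto
  moreover have "card (interval r x z \<inter> A) = 1" if proper: "z \<noteq> x" "z \<noteq> y"
  proof -
    obtain a where "{b \<in> A. (b, z) \<in> r} = {a}"
      using unique[of z] proper z by blast
    moreover have "interval r x z \<inter> A = {b \<in> A. (b, z) \<in> r}"
      using A by (auto simp: interval_def)
    ultimately show ?thesis by simp
  qed
  ultimately show ?thesis by auto
qed

lemma mobius_disjoint_cones:
  assumes r: "Partial_order r" "finite (interval r x y)" "(x, y) \<in> r" "x \<noteq> y"
    and A: "A \<subseteq> interval r x y - {x, y}"
    and cones: "\<And>z. z \<in> interval r x y - {x, y} \<Longrightarrow> \<exists>!a. a \<in> A \<and> (a, z) \<in> r"
  shows "mobius r x y = int (card A) - 1"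
proof -
  define g where
    "g w = of_bool (w = x) + of_bool (w = y) * (int (card A) - 1) - of_bool (w \<in> A)" for w
  have "mobius r x y = g y"
  proof (rule mobius_unique[OF r(1-3)])
    fix z assume z: "z \<in> interval r x y"
    let ?J = "interval r x z"
    have "x \<in> ?J"
      using r z by (intro interval_endpoints) (auto simp: interval_def)
    moreover have "finite ?J"
      using interval_subinterval[OF r(1) z] r(2) by (rule finite_subset)
    ultimately have "sum g ?J = 1 + of_bool (y \<in> ?J) * (int (card A) - 1) - int (card (?J \<inter> A))"
      by (simp add: g_def sum.distrib sum_subtractf flip: sum_distrib_right)
    also have "y \<in> ?J \<longleftrightarrow> z = y"
      using z r(1,3) antisymD[OF partial_order_onD(3)[OF r(1)], of y z]
        interval_endpoints(2)[of r x y]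
      by (auto simp: interval_def)
    finally show "sum g ?J = (if z = x then 1 else 0)"
      using card_unique_below[OF r(1) A cones z] r(4) by auto
  qed
  moreover have "y \<notin> A"
    using A by blast
  ultimately show ?thesis
    using r(4) by (simp add: g_def)
qed

section \<open>The crystal order\<close>

lemma ssytI:
  assumes "\<And>r c. (r, c) \<notin> diagram lam \<Longrightarrow> T (r, c) = 0"
    and "\<And>r c. (r, c) \<in> diagram lam \<Longrightarrow> 0 < T (r, c) \<and> T (r, c) \<le> n"
    and "\<And>r c c'. c < c' \<Longrightarrow> (r, c) \<in> diagram lam \<Longrightarrow> (r, c') \<in> diagram lam \<Longrightarrow> T (r, c) \<le> T (r, c')"
    and "\<And>r r' c. r < r' \<Longrightarrow> (r, c) \<in> diagram lam \<Longrightarrow> (r', c) \<in> diagram lam \<Longrightarrow> T (r, c) < T (r', c)"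
  shows "T \<in> ssyt n lam"
  using assms by (auto simp: ssyt_def Suc_le_eq)

lemma ssyt_outside: "T \<in> ssyt n lam \<Longrightarrow> x \<notin> diagram lam \<Longrightarrow> T x = 0"
  by (cases x) (simp add: ssyt_def)

lemma ssyt_pos: "T \<in> ssyt n lam \<Longrightarrow> x \<in> diagram lam \<Longrightarrow> 0 < T x"
  by (fastforce simp: ssyt_def)

lemma ssyt_le: "T \<in> ssyt n lam \<Longrightarrow> T x \<le> n"
  by (cases "x \<in> diagram lam") (fastforce simp: ssyt_def, simp add: ssyt_outside)

lemma ssyt_row_mono:
  "T \<in> ssyt n lam \<Longrightarrow> c < c' \<Longrightarrow> (r, c) \<in> diagram lam \<Longrightarrow> (r, c') \<in> diagram lam \<Longrightarrow> T (r, c) \<le> T (r, c')"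
  by (simp add: ssyt_def)

lemma ssyt_column_strict_mono:
  "T \<in> ssyt n lam \<Longrightarrow> r < r' \<Longrightarrow> (r, c) \<in> diagram lam \<Longrightarrow> (r', c) \<in> diagram lam \<Longrightarrow> T (r, c) < T (r', c)"
  by (simp add: ssyt_def)

lemma crystal_step_imp_order:
  "(S, T) \<in> crystal_step n lam \<Longrightarrow> T \<in> ssyt n lam \<Longrightarrow> (S, T) \<in> crystal_order n lam"
  by (auto simp: crystal_order_def crystal_step_def)

lemma crystal_order_refl: "T \<in> ssyt n lam \<Longrightarrow> (T, T) \<in> crystal_order n lam"
  by (simp add: crystal_order_def)

lemma crystal_order_trans:
  "(S, T) \<in> crystal_order n lam \<Longrightarrow> (T, U) \<in> crystal_order n lam \<Longrightarrow> (S, U) \<in> crystal_order n lam"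
  by (rule transD[OF partial_order_onD(2)[OF Partial_order_crystal_order]])

lemma crystal_order_induct [consumes 1, case_names base step]:
  assumes "(S, T) \<in> crystal_order n lam"
    and base: "P S"
    and "\<And>X Y. (S, X) \<in> crystal_order n lam \<Longrightarrow> (X, Y) \<in> crystal_step n lam \<Longrightarrow>
      (Y, T) \<in> crystal_order n lam \<Longrightarrow> P X \<Longrightarrow> P Y"
  shows "P T"
proof -
  have ST: "S \<in> ssyt n lam" "T \<in> ssyt n lam" "(S, T) \<in> (crystal_step n lam)\<^sup>*"
    using assms(1) by (auto simp: crystal_order_def)
  have ssyt: "Y \<in> ssyt n lam" if "(Y, T) \<in> (crystal_step n lam)\<^sup>*" for Y
    using that ST(2) by (cases rule: converse_rtranclE) (auto simp: crystal_step_def)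
  have "P Y" if "(S, Y) \<in> (crystal_step n lam)\<^sup>*" "(Y, T) \<in> (crystal_step n lam)\<^sup>*" for Y
    using that
  proof (induction rule: rtrancl_induct)
    case (step X Y)
    have "(X, T) \<in> (crystal_step n lam)\<^sup>*"
      using step.hyps(2) step.prems by (rule converse_rtrancl_into_rtrancl)
    then show ?case
      using assms(3)[of X Y] ssyt step ST by (auto simp: crystal_order_def)
  qed (rule base)
  then show ?thesis
    using ST(3) by blast
qed

lemma crystal_order_map:
  assumes "(S, T) \<in> crystal_order n lam"
    and ssyt: "\<And>X. X \<in> ssyt n lam \<Longrightarrow> f X \<in> ssyt n' lam'"
    and step: "\<And>X Y. (X, Y) \<in> crystal_step n lam \<Longrightarrow> (f X, f Y) \<in> crystal_step n' lam'"
  shows "(f S, f T) \<in> crystal_order n' lam'"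
proof -
  have "(S, T) \<in> (crystal_step n lam)\<^sup>*" "S \<in> ssyt n lam" "T \<in> ssyt n lam"
    using assms(1) by (auto simp: crystal_order_def)
  moreover from this(1) have "(f S, f T) \<in> (crystal_step n' lam')\<^sup>*"
    by induction (auto intro: step rtrancl_into_rtrancl)
  ultimately show ?thesis
    using ssyt by (simp add: crystal_order_def)
qed

lemma crystal_order_le:
  assumes "(S, T) \<in> crystal_order n lam"
  shows "S \<le> T"
  using assms
proof (induction rule: crystal_order_induct)
  case (step X Y)
  then obtain x where "Y = X(x := Suc (X x))"
    by (auto simp: crystal_step_def elim: crystal_f_SomeE)
  then have "X \<le> Y"
    by (simp add: le_fun_def)
  with step.IH show ?case by (rule order_trans)
qed simp

definition plus_cells :: "nat list \<Rightarrow> nat \<Rightarrow> tableau \<Rightarrow> cell list" where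
  "plus_cells lam i T = [x. (s, x) \<leftarrow> cancel (signature lam i T), s = Plus]"

lemma crystal_f_plus_cells:
  "crystal_f lam i T =
     (if plus_cells lam i T = [] then None else Some (T(last (plus_cells lam i T) := Suc i)))"
  by (simp add: crystal_f_def plus_cells_def Let_def)

lemma plus_cells_subset_diagram: "set (plus_cells lam i T) \<subseteq> diagram lam"
  using cancel_subset[of "signature lam i T"]
  by (auto simp: plus_cells_def signature_def reading_cells_def)

section \<open>Stacking tableaux\<close>

definition shift_rows :: "nat \<Rightarrow> cell \<Rightarrow> cell" where
  "shift_rows m = map_prod ((+) m) id"

lemma shift_rows_Pair [simp]: "shift_rows m (r, c) = (m + r, c)"
  by (simp add: shift_rows_def)

lemma cell_row_cases:
  fixes x :: cell
  obtains (top) "fst x < m" | (bottom) y where "x = shift_rows m y"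
proof (cases "fst x < m")
  case False
  then have "x = shift_rows m (fst x - m, snd x)" by (simp add: prod_eq_iff)
  with bottom show thesis .
qed (rule top)

lemma diagram_append_top:
  "fst x < length lam \<Longrightarrow> x \<in> diagram (lam @ lam') \<longleftrightarrow> x \<in> diagram lam"
  by (auto simp: diagram_def nth_append)

lemma diagram_append_shift:
  "shift_rows (length lam) x \<in> diagram (lam @ lam') \<longleftrightarrow> x \<in> diagram lam'"
  by (cases x) (simp add: diagram_def nth_append)

text \<open>The inner case distinction keeps the cells off the diagram 0.\<close>

definition stack :: "nat list \<Rightarrow> nat \<Rightarrow> tableau \<Rightarrow> tableau \<Rightarrow> tableau" where
  "stack lam n S T = (\<lambda>(r, c).
     if r < length lam then S (r, c)
     else if T (r - length lam, c) = 0 then 0 else n + T (r - length lam, c))"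

lemma stack_top: "fst x < length lam \<Longrightarrow> stack lam n S T x = S x"
  by (cases x) (simp add: stack_def)

lemma stack_shift: "stack lam n S T (shift_rows (length lam) x) = (if T x = 0 then 0 else n + T x)"
  by (cases x) (simp add: stack_def)

lemma stack_update_top:
  "fst x < length lam \<Longrightarrow> stack lam n (S(x := k)) T = (stack lam n S T)(x := k)"
  by (auto simp: stack_def fun_eq_iff)

lemma stack_update_bottom:
  "0 < k \<Longrightarrow> stack lam n S (T(x := k)) = (stack lam n S T)(shift_rows (length lam) x := n + k)"
  by (cases x) (auto simp: stack_def fun_eq_iff)

lemma stack_inject:
  assumes outside: "\<And>x. x \<notin> diagram lam \<Longrightarrow> S x = 0" "\<And>x. x \<notin> diagram lam \<Longrightarrow> S' x = 0"
    and eq: "stack lam n S T = stack lam n S' T'"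
  shows "S = S' \<and> T = T'"
proof (intro conjI ext)
  fix x :: cell
  have "S x = S' x" if "fst x < length lam"
    using fun_cong[OF eq, of x] that by (simp add: stack_top)
  moreover have "x \<notin> diagram lam" if "\<not> fst x < length lam"
    using that by (auto simp: diagram_def)
  ultimately show "S x = S' x"
    using outside by metis
  show "T x = T' x"
    using fun_cong[OF eq, of "shift_rows (length lam) x"]
    by (simp add: stack_shift split: if_splits)
qed

lemma stack_ssyt:
  assumes S: "S \<in> ssyt n lam" and T: "T \<in> ssyt n' lam'"
  shows "stack lam n S T \<in> ssyt (n + n') (lam @ lam')"
proof (rule ssytI)
  fix r c c' assume "c < c'" "(r, c) \<in> diagram (lam @ lam')" "(r, c') \<in> diagram (lam @ lam')"
  then show "stack lam n S T (r, c) \<le> stack lam n S T (r, c')"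
    using ssyt_row_mono[OF S, of c c' r] ssyt_row_mono[OF T, of c c' "r - length lam"]
    by (auto simp: stack_def diagram_def nth_append less_diff_conv2 not_less split: if_splits)
next
  fix r r' c assume "r < r'" "(r, c) \<in> diagram (lam @ lam')" "(r', c) \<in> diagram (lam @ lam')"
  then show "stack lam n S T (r, c) < stack lam n S T (r', c)"
    using ssyt_column_strict_mono[OF S, of r r' c] ssyt_le[OF S, of "(r, c)"]
      ssyt_column_strict_mono[OF T, of "r - length lam" "r' - length lam" c]
      ssyt_pos[OF T, of "(r' - length lam, c)"]
    by (auto simp: stack_def diagram_def nth_append split: if_splits)
next
  fix r c
  show "stack lam n S T (r, c) = 0" if "(r, c) \<notin> diagram (lam @ lam')"
    using that ssyt_outside[OF S, of "(r, c)"] ssyt_outside[OF T, of "(r - length lam, c)"]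
    by (cases "r < length lam")
      (auto simp: stack_def diagram_def nth_append less_diff_conv2 not_less)
  show "0 < stack lam n S T (r, c) \<and> stack lam n S T (r, c) \<le> n + n'"
    if "(r, c) \<in> diagram (lam @ lam')"
    using that ssyt_pos[OF S, of "(r, c)"] ssyt_le[OF S, of "(r, c)"]
      ssyt_pos[OF T, of "(r - length lam, c)"] ssyt_le[OF T, of "(r - length lam, c)"]
    by (auto simp: stack_def diagram_def nth_append split: if_splits)
qed

lemma stack_ssytD:
  assumes ST: "stack lam n S T \<in> ssyt (n + n') (lam @ lam')"
    and S: "\<And>x. S x \<le> n" "\<And>x. x \<notin> diagram lam \<Longrightarrow> S x = 0"
    and T: "\<And>x. x \<in> diagram lam' \<Longrightarrow> 0 < T x"
  shows "S \<in> ssyt n lam" "T \<in> ssyt n' lam'"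
proof -
  have top: "stack lam n S T (r, c) = S (r, c) \<and> (r, c) \<in> diagram (lam @ lam')"
    if "(r, c) \<in> diagram lam" for r c
    using that by (auto simp: stack_def diagram_def nth_append)
  show "S \<in> ssyt n lam"
  proof (rule ssytI)
    show "0 < S (r, c) \<and> S (r, c) \<le> n" if "(r, c) \<in> diagram lam" for r c
      using ssyt_pos[OF ST, of "(r, c)"] S(1) top[OF that] by simp
    show "S (r, c) \<le> S (r, c')"
      if "c < c'" "(r, c) \<in> diagram lam" "(r, c') \<in> diagram lam" for r c c'
      using ssyt_row_mono[OF ST that(1)] that(2,3)[THEN top] by metis
    show "S (r, c) < S (r', c)"
      if "r < r'" "(r, c) \<in> diagram lam" "(r', c) \<in> diagram lam" for r r' c
      using ssyt_column_strict_mono[OF ST that(1)] that(2,3)[THEN top] by metis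
  qed (rule S(2))
  have bottom: "stack lam n S T (length lam + r, c) = n + T (r, c) \<and>
      (length lam + r, c) \<in> diagram (lam @ lam')"
    if "(r, c) \<in> diagram lam'" for r c
    using that T[OF that] by (auto simp: stack_def diagram_def nth_append)
  show "T \<in> ssyt n' lam'"
  proof (rule ssytI)
    show "T (r, c) = 0" if "(r, c) \<notin> diagram lam'" for r c
      using ssyt_outside[OF ST, of "shift_rows (length lam) (r, c)"] that
      by (simp only: diagram_append_shift stack_shift) (simp split: if_splits)
    show "0 < T (r, c) \<and> T (r, c) \<le> n'" if "(r, c) \<in> diagram lam'" for r c
      using ssyt_le[OF ST, of "(length lam + r, c)"] T[OF that] bottom[OF that] by simp
    show "T (r, c) \<le> T (r, c')"
      if "c < c'" "(r, c) \<in> diagram lam'" "(r, c') \<in> diagram lam'" for r c c'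
      using ssyt_row_mono[OF ST that(1), of "length lam + r"] that(2,3)[THEN bottom] by simp
    show "T (r, c) < T (r', c)"
      if "r < r'" "(r, c) \<in> diagram lam'" "(r', c) \<in> diagram lam'" for r r' c
      using ssyt_column_strict_mono[OF ST, of "length lam + r" "length lam + r'" c] that(1)
        that(2,3)[THEN bottom] by simp
  qed
qed

lemma stack_convex:
  assumes S: "S \<in> ssyt n lam" "S' \<in> ssyt n lam" and T: "T \<in> ssyt n' lam'"
    and Z: "Z \<in> ssyt (n + n') (lam @ lam')" "stack lam n S T \<le> Z" "Z \<le> stack lam n S' T'"
  obtains S0 T0 where "S0 \<in> ssyt n lam" "T0 \<in> ssyt n' lam'" "Z = stack lam n S0 T0"
proof -
  define S0 :: tableau where "S0 x = (if fst x < length lam then Z x else 0)" for x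
  define T0 :: tableau where "T0 x = Z (shift_rows (length lam) x) - n" for x
  have Z_top: "Z x \<le> n" if "fst x < length lam" for x
    using ssyt_le[OF S(2), of x] le_funD[OF Z(3), of x] stack_top[OF that, of n S' T'] by simp
  have Z_bottom: "n < Z (shift_rows (length lam) x)" if "x \<in> diagram lam'" for x
    using ssyt_pos[OF T that] le_funD[OF Z(2), of "shift_rows (length lam) x"]
    by (simp add: stack_shift)
  have Z_outside: "Z (shift_rows (length lam) x) = 0" if "x \<notin> diagram lam'" for x
    using ssyt_outside[OF Z(1), of "shift_rows (length lam) x"] that
    by (simp add: diagram_append_shift)
  have "Z x = stack lam n S0 T0 x" for x
  proof (cases x rule: cell_row_cases[of _ "length lam"])
    case (bottom y)
    then show ?thesis
      using Z_bottom[of y] Z_outside[of y]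
      by (cases "y \<in> diagram lam'") (auto simp: stack_shift T0_def)
  qed (simp add: stack_top S0_def)
  then have eq: "Z = stack lam n S0 T0" by blast
  have "S0 x \<le> n" for x
    using Z_top by (simp add: S0_def)
  moreover have "S0 x = 0" if "x \<notin> diagram lam" for x
    using ssyt_outside[OF Z(1), of x] that by (simp add: S0_def diagram_append_top)
  moreover have "0 < T0 x" if "x \<in> diagram lam'" for x
    using Z_bottom[OF that] by (simp add: T0_def)
  ultimately have "S0 \<in> ssyt n lam" "T0 \<in> ssyt n' lam'"
    using stack_ssytD Z(1) unfolding eq by blast+
  then show thesis
    using eq that by blast
qed

definition column_cells :: "nat list \<Rightarrow> nat \<Rightarrow> cell list" where
  "column_cells lam c = filter (\<lambda>x. x \<in> diagram lam) (map (\<lambda>r. (r, c)) (rev [0..<length lam]))"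

lemma reading_cells_eq_columns:
  assumes "\<And>k. k \<in> set lam \<Longrightarrow> k \<le> w"
  shows "reading_cells lam = concat (map (column_cells lam) [0..<w])"
proof -
  define v where "v = Max (set (0 # lam))"
  have "v \<le> w"
    using assms by (simp add: v_def)
  moreover have "column_cells lam c = []" if "v \<le> c" for c
  proof -
    have "lam ! r \<le> c" if "r < length lam" for r
      using that \<open>v \<le> c\<close> by (auto simp: v_def intro: order_trans)
    then show ?thesis
      by (auto simp: column_cells_def filter_empty_conv diagram_def not_less)
  qed
  ultimately
  have "concat (map (column_cells lam) [0..<w]) = concat (map (column_cells lam) [0..<v])"
    using upt_add_eq_append[of 0 v "w - v"] by simp
  then show ?thesis
    by (simp add: reading_cells_def column_cells_def[abs_def] v_def)
qed

lemma set_column_cells: "set (column_cells lam c) \<subseteq> diagram lam"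
  by (auto simp: column_cells_def)

lemma column_cells_append:
  "column_cells (lam @ lam') c =
    map (shift_rows (length lam)) (column_cells lam' c) @ column_cells lam c"
proof -
  have "[m..<m + k] = map ((+) m) [0..<k]" for m k :: nat
    by (induction k) auto
  then have "[0..<length lam + length lam'] =
      [0..<length lam] @ map ((+) (length lam)) [0..<length lam']"
    by (simp add: upt_add_eq_append[of 0])
  then show ?thesis
    by (auto simp: column_cells_def filter_map comp_def rev_map diagram_def nth_append
        intro!: arg_cong[of _ _ "map _"] filter_cong)
qed

lemma filter_reading_cells_append_top:
  assumes "\<And>x. x \<in> diagram lam' \<Longrightarrow> \<not> P (shift_rows (length lam) x)"
  shows "filter P (reading_cells (lam @ lam')) = filter P (reading_cells lam)"
proof -
  define w where "w = Max (set (0 # lam @ lam'))"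
  have "filter P (column_cells (lam @ lam') c) = filter P (column_cells lam c)" for c
    using assms set_column_cells[of lam' c] by (auto simp: column_cells_append filter_empty_conv)
  then show ?thesis
    using reading_cells_eq_columns[of "lam @ lam'" w] reading_cells_eq_columns[of lam w]
    by (simp add: w_def filter_concat comp_def)
qed

lemma filter_reading_cells_append_bottom:
  assumes "\<And>x. x \<in> diagram lam \<Longrightarrow> \<not> P x"
  shows "filter P (reading_cells (lam @ lam')) =
    map (shift_rows (length lam)) (filter (P \<circ> shift_rows (length lam)) (reading_cells lam'))"
proof -
  define w where "w = Max (set (0 # lam @ lam'))"
  have "filter P (column_cells (lam @ lam') c) =
      map (shift_rows (length lam)) (filter (P \<circ> shift_rows (length lam)) (column_cells lam' c))"
    for c
    using assms set_column_cells[of lam c]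
    by (auto simp: column_cells_append filter_map filter_empty_conv)
  then show ?thesis
    using reading_cells_eq_columns[of "lam @ lam'" w] reading_cells_eq_columns[of lam' w]
    by (simp add: w_def filter_concat map_concat comp_def)
qed

lemma cancel_map: "cancel (map (apsnd g) w) = map (apsnd g) (cancel w)"
proof (induction w)
  case (Cons p w)
  have "cancel_cons (apsnd g p) (map (apsnd g) v) = map (apsnd g) (cancel_cons p v)" for v
    by (cases "(p, v)" rule: cancel_cons.cases) auto
  with Cons show ?case by (simp add: cancel_def del: id_apply)
qed (simp add: cancel_def)

lemma signature_stack_top:
  assumes "1 \<le> i" "i < n"
  shows "signature (lam @ lam') i (stack lam n S T) = signature lam i S"
proof -
  have cells: "stack lam n S T x = S x" if "x \<in> set (reading_cells lam)" for x
    using that by (auto simp: reading_cells_def diagram_def stack_top)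
  have "filter (\<lambda>x. stack lam n S T x = i \<or> stack lam n S T x = Suc i) (reading_cells (lam @ lam'))
      = filter (\<lambda>x. stack lam n S T x = i \<or> stack lam n S T x = Suc i) (reading_cells lam)"
    using assms by (intro filter_reading_cells_append_top) (simp add: stack_shift)
  also have "\<dots> = filter (\<lambda>x. S x = i \<or> S x = Suc i) (reading_cells lam)"
    using cells by (intro filter_cong) auto
  finally show ?thesis
    using cells by (auto simp: signature_def)
qed

lemma signature_stack_bottom:
  assumes "1 \<le> i" and S: "S \<in> ssyt n lam"
  shows "signature (lam @ lam') (n + i) (stack lam n S T) =
    map (apsnd (shift_rows (length lam))) (signature lam' i T)"
proof -
  define has_letter where
    "has_letter x \<longleftrightarrow> stack lam n S T x = n + i \<or> stack lam n S T x = Suc (n + i)" for x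
  have "\<not> has_letter x" if "x \<in> diagram lam" for x
    using that assms(1) ssyt_le[OF S, of x] by (auto simp: has_letter_def diagram_def stack_top)
  then have "filter has_letter (reading_cells (lam @ lam')) =
      map (shift_rows (length lam))
        (filter (has_letter \<circ> shift_rows (length lam)) (reading_cells lam'))"
    by (rule filter_reading_cells_append_bottom)
  moreover have "has_letter \<circ> shift_rows (length lam) = (\<lambda>x. T x = i \<or> T x = Suc i)"
    using assms(1) by (auto simp: has_letter_def stack_shift fun_eq_iff)
  ultimately show ?thesis
    using assms(1) by (auto simp: signature_def has_letter_def[abs_def] stack_shift)
qed

lemma crystal_f_stack_top:
  assumes "1 \<le> i" "i < n"
  shows "crystal_f (lam @ lam') i (stack lam n S T) =
    map_option (\<lambda>S'. stack lam n S' T) (crystal_f lam i S)"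
proof -
  have cells: "plus_cells (lam @ lam') i (stack lam n S T) = plus_cells lam i S"
    by (simp add: plus_cells_def signature_stack_top[OF assms])
  have "fst (last (plus_cells lam i S)) < length lam" if "plus_cells lam i S \<noteq> []"
    using last_in_set[OF that] plus_cells_subset_diagram[of lam i S] by (auto simp: diagram_def)
  then show ?thesis
    by (simp add: crystal_f_plus_cells cells stack_update_top)
qed

lemma crystal_f_stack_bottom:
  assumes "1 \<le> i" "S \<in> ssyt n lam"
  shows "crystal_f (lam @ lam') (n + i) (stack lam n S T) =
    map_option (stack lam n S) (crystal_f lam' i T)"
proof -
  have "plus_cells (lam @ lam') (n + i) (stack lam n S T) =
      map (shift_rows (length lam)) (plus_cells lam' i T)"
    by (auto simp: plus_cells_def signature_stack_bottom[OF assms] cancel_map map_concat comp_def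
        intro!: arg_cong[of _ _ concat])
  then show ?thesis
    by (simp add: crystal_f_plus_cells stack_update_bottom last_map)
qed

text \<open>\<open>f\<^sub>n\<close> is the only operator that could mix the two alphabets.\<close>

lemma crystal_f_stack_cross:
  assumes "0 < n" "S' \<in> ssyt n lam"
  shows "crystal_f (lam @ lam') n (stack lam n S T) \<noteq> Some (stack lam n S' T')"
proof
  assume "crystal_f (lam @ lam') n (stack lam n S T) = Some (stack lam n S' T')"
  then obtain x where x: "stack lam n S T x = n" "stack lam n S' T' = (stack lam n S T)(x := Suc n)"
    by (rule crystal_f_SomeE)
  show False
  proof (cases x rule: cell_row_cases[of _ "length lam"])
    case top
    then have "S' x = Suc n"
      using fun_cong[OF x(2), of x] by (simp add: stack_top)
    then show False
      using ssyt_le[OF assms(2), of x] by simp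
  next
    case (bottom y)
    then show False
      using x(1) assms(1) by (simp add: stack_shift split: if_splits)
  qed
qed

lemma crystal_step_stack_top:
  assumes "(S, S') \<in> crystal_step n lam" "T \<in> ssyt n' lam'"
  shows "(stack lam n S T, stack lam n S' T) \<in> crystal_step (n + n') (lam @ lam')"
proof -
  obtain i where i: "i \<in> {1..<n}" "crystal_f lam i S = Some S'" and S: "S \<in> ssyt n lam"
    using assms(1) by (auto simp: crystal_step_def)
  then have "crystal_f (lam @ lam') i (stack lam n S T) = Some (stack lam n S' T)"
    by (simp add: crystal_f_stack_top)
  moreover have "i \<in> {1..<n + n'}"
    using i(1) by simp
  ultimately show ?thesis
    using stack_ssyt[OF S assms(2)] unfolding crystal_step_def by blast
qed

lemma crystal_step_stack_bottom:
  assumes "(T, T') \<in> crystal_step n' lam'" "S \<in> ssyt n lam"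
  shows "(stack lam n S T, stack lam n S T') \<in> crystal_step (n + n') (lam @ lam')"
proof -
  obtain i where i: "i \<in> {1..<n'}" "crystal_f lam' i T = Some T'" and T: "T \<in> ssyt n' lam'"
    using assms(1) by (auto simp: crystal_step_def)
  then have "crystal_f (lam @ lam') (n + i) (stack lam n S T) = Some (stack lam n S T')"
    using assms(2) by (simp add: crystal_f_stack_bottom)
  moreover have "n + i \<in> {1..<n + n'}"
    using i(1) by simp
  ultimately show ?thesis
    using stack_ssyt[OF assms(2) T] unfolding crystal_step_def by blast
qed

lemma crystal_step_stackD:
  assumes S: "S \<in> ssyt n lam" "S' \<in> ssyt n lam" and T: "T \<in> ssyt n' lam'"
    and step: "(stack lam n S T, stack lam n S' T') \<in> crystal_step (n + n') (lam @ lam')"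
  shows "(S, S') \<in> crystal_step n lam \<and> T = T' \<or> S = S' \<and> (T, T') \<in> crystal_step n' lam'"
proof -
  obtain i where i: "1 \<le> i" "i < n + n'"
    and f: "crystal_f (lam @ lam') i (stack lam n S T) = Some (stack lam n S' T')"
    using step by (auto simp: crystal_step_def)
  consider (top) "i < n" | (cross) "i = n" | (bottom) k where "i = n + k" "1 \<le> k"
    using that(3)[of "i - n"] by fastforce
  then show ?thesis
  proof cases
    case top
    then obtain U where U: "crystal_f lam i S = Some U" "stack lam n U T = stack lam n S' T'"
      using f i by (auto simp: crystal_f_stack_top)
    have "U x = 0" if "x \<notin> diagram lam" for x
      using U(1) by (rule crystal_f_SomeE) (use that ssyt_outside[OF S(1)] in auto)
    then have "U = S' \<and> T = T'"
      using U(2) ssyt_outside[OF S(2)] by (intro stack_inject)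
    then show ?thesis
      using top i U(1) S(1) by (auto simp: crystal_step_def)
  next
    case cross
    then show ?thesis
      using f i S(2) by (simp add: crystal_f_stack_cross)
  next
    case (bottom k)
    then obtain V where V: "crystal_f lam' k T = Some V" "stack lam n S V = stack lam n S' T'"
      using f S(1) by (auto simp: crystal_f_stack_bottom)
    then have "S = S' \<and> V = T'"
      using S[THEN ssyt_outside] by (intro stack_inject)
    then show ?thesis
      using bottom i V(1) T by (auto simp: crystal_step_def)
  qed
qed

lemma crystal_step_from_stackE:
  assumes ssyt: "S \<in> ssyt n lam" "T \<in> ssyt n' lam'" "S' \<in> ssyt n lam"
    and step: "(stack lam n S T, Z) \<in> crystal_step (n + n') (lam @ lam')"
    and below: "(Z, stack lam n S' T') \<in> crystal_order (n + n') (lam @ lam')"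
  obtains U V where "Z = stack lam n U V"
    "(S, U) \<in> crystal_order n lam" "(T, V) \<in> crystal_order n' lam'"
proof -
  have Z: "Z \<in> ssyt (n + n') (lam @ lam')"
    using below by (simp add: crystal_order_def)
  obtain U V where UV: "U \<in> ssyt n lam" "V \<in> ssyt n' lam'" "Z = stack lam n U V"
    using stack_convex[OF ssyt(1,3,2) Z] crystal_order_le[OF crystal_step_imp_order[OF step Z]]
      crystal_order_le[OF below] by blast
  then have "(S, U) \<in> crystal_step n lam \<and> T = V \<or> S = U \<and> (T, V) \<in> crystal_step n' lam'"
    using ssyt step by (intro crystal_step_stackD) auto
  then show thesis
    using that[OF UV(3)] UV(1,2) by (auto intro: crystal_step_imp_order crystal_order_refl)
qed

lemma crystal_order_stackD:
  assumes ssyt: "S \<in> ssyt n lam" "T \<in> ssyt n' lam'" "S' \<in> ssyt n lam"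
    and le: "(stack lam n S T, stack lam n S' T') \<in> crystal_order (n + n') (lam @ lam')"
  shows "(S, S') \<in> crystal_order n lam \<and> (T, T') \<in> crystal_order n' lam'"
proof -
  have "\<exists>U V. stack lam n S' T' = stack lam n U V \<and>
      (S, U) \<in> crystal_order n lam \<and> (T, V) \<in> crystal_order n' lam'"
    using le
  proof (induction rule: crystal_order_induct)
    case base
    then show ?case
      using ssyt crystal_order_refl by blast
  next
    case (step X Y)
    then obtain U V where UV: "X = stack lam n U V"
      "(S, U) \<in> crystal_order n lam" "(T, V) \<in> crystal_order n' lam'"
      by blast
    then have "U \<in> ssyt n lam" "V \<in> ssyt n' lam'"
      by (auto simp: crystal_order_def)
    then obtain U' V' where "Y = stack lam n U' V'"
      "(U, U') \<in> crystal_order n lam" "(V, V') \<in> crystal_order n' lam'"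
      using crystal_step_from_stackE ssyt(3) step.hyps(2,3) unfolding UV(1) by blast
    then show ?case
      using UV(2,3) crystal_order_trans by blast
  qed
  then obtain U V where UV: "stack lam n S' T' = stack lam n U V"
    "(S, U) \<in> crystal_order n lam" "(T, V) \<in> crystal_order n' lam'"
    by blast
  then have "U \<in> ssyt n lam"
    by (simp add: crystal_order_def)
  then have "S' = U \<and> T' = V"
    using UV(1) ssyt(3) by (intro stack_inject) (auto dest: ssyt_outside)
  with UV show ?thesis by simp
qed

lemma crystal_order_stack_iff:
  assumes "S \<in> ssyt n lam" "T \<in> ssyt n' lam'" "S' \<in> ssyt n lam"
  shows "(stack lam n S T, stack lam n S' T') \<in> crystal_order (n + n') (lam @ lam') \<longleftrightarrow>
    (S, S') \<in> crystal_order n lam \<and> (T, T') \<in> crystal_order n' lam'"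
    (is "?lhs \<longleftrightarrow> ?rhs")
proof
  assume ?rhs
  then have "(stack lam n S T, stack lam n S' T) \<in> crystal_order (n + n') (lam @ lam')"
    "(stack lam n S' T, stack lam n S' T') \<in> crystal_order (n + n') (lam @ lam')"
    using assms crystal_order_map[where f = "\<lambda>X. stack lam n X T"]
      crystal_order_map[where f = "stack lam n S'"]
      crystal_step_stack_top crystal_step_stack_bottom stack_ssyt by metis+
  then show ?lhs by (rule crystal_order_trans)
qed (rule crystal_order_stackD[OF assms])

lemma interval_stack_subset:
  assumes ssyt: "S \<in> ssyt n lam" "T \<in> ssyt n' lam'" "S' \<in> ssyt n lam"
  shows "interval (crystal_order (n + n') (lam @ lam')) (stack lam n S T) (stack lam n S' T') \<subseteq>
    case_prod (stack lam n) `
      (interval (crystal_order n lam) S S' \<times> interval (crystal_order n' lam') T T')"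
proof
  fix Z
  assume "Z \<in> interval (crystal_order (n + n') (lam @ lam')) (stack lam n S T) (stack lam n S' T')"
  then have Z: "(stack lam n S T, Z) \<in> crystal_order (n + n') (lam @ lam')"
    "(Z, stack lam n S' T') \<in> crystal_order (n + n') (lam @ lam')"
    by (auto simp: interval_def)
  then have "Z \<in> ssyt (n + n') (lam @ lam')"
    by (simp add: crystal_order_def)
  then obtain U V where UV: "U \<in> ssyt n lam" "V \<in> ssyt n' lam'" "Z = stack lam n U V"
    using stack_convex[OF ssyt(1,3,2), of Z T'] Z[THEN crystal_order_le] by blast
  then show "Z \<in> case_prod (stack lam n) `
      (interval (crystal_order n lam) S S' \<times> interval (crystal_order n' lam') T T')"
    using Z ssyt by (auto simp: crystal_order_stack_iff interval_def)
qed

lemma mobius_stack: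
  assumes S: "(S, S') \<in> crystal_order n lam" and T: "(T, T') \<in> crystal_order n' lam'"
  shows "mobius (crystal_order (n + n') (lam @ lam')) (stack lam n S T) (stack lam n S' T') =
    mobius (crystal_order n lam) S S' * mobius (crystal_order n' lam') T T'"
proof -
  let ?r = "crystal_order (n + n') (lam @ lam')"
    and ?p = "product_order (crystal_order n lam) (crystal_order n' lam')"
    and ?stack = "case_prod (stack lam n)"
  have ssyt: "S \<in> ssyt n lam" "T \<in> ssyt n' lam'" "S' \<in> ssyt n lam"
    using S T by (auto simp: crystal_order_def)
  have "mobius ?r (?stack (S, T)) (?stack (S', T')) = mobius ?p (S, T) (S', T')"
  proof (rule mobius_order_embedding)
    show "finite (interval ?p (S, T) (S', T'))"
      by (simp add: interval_product_order finite_interval_crystal_order)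
    show "((S, T), S', T') \<in> ?p"
      using S T by (simp add: product_order_def)
    show "(?stack a, ?stack b) \<in> ?r \<longleftrightarrow> (a, b) \<in> ?p"
      if "a \<in> interval ?p (S, T) (S', T')" "b \<in> interval ?p (S, T) (S', T')" for a b
    proof -
      have "fst a \<in> ssyt n lam" "snd a \<in> ssyt n' lam'" "fst b \<in> ssyt n lam"
        using that unfolding interval_product_order by (auto simp: interval_def crystal_order_def)
      then show ?thesis
        by (simp add: case_prod_unfold product_order_def crystal_order_stack_iff)
    qed
    show "interval ?r (?stack (S, T)) (?stack (S', T')) \<subseteq> ?stack ` interval ?p (S, T) (S', T')"
      using interval_stack_subset[OF ssyt] by (simp add: interval_product_order)
  qed (intro Partial_order_product_order Partial_order_crystal_order)+
  also have "\<dots> = mobius (crystal_order n lam) S S' * mobius (crystal_order n' lam') T T'"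
    using S T
    by (intro mobius_product_order Partial_order_crystal_order finite_interval_crystal_order)
  finally show ?thesis by simp
qed

section \<open>An interval with Moebius function 2\<close>

definition tableau_of_rows :: "nat list list \<Rightarrow> tableau" where
  "tableau_of_rows rows =
    (\<lambda>(r, c). if r < length rows \<and> c < length (rows ! r) then rows ! r ! c else 0)"

lemma tableau_of_rows_apply:
  "tableau_of_rows rows (r, c) =
    (if r < length rows \<and> c < length (rows ! r) then rows ! r ! c else 0)"
  by (simp add: tableau_of_rows_def)

lemma tableau_of_rows_update:
  assumes "r < length rows" "c < length (rows ! r)"
  shows "(tableau_of_rows rows)((r, c) := k) = tableau_of_rows (rows[r := (rows ! r)[c := k]])"
  using assms by (auto simp: tableau_of_rows_def fun_eq_iff nth_list_update)

lemma tableau_of_rows_inject: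
  assumes "map length rows = map length rows'"
  shows "tableau_of_rows rows = tableau_of_rows rows' \<longleftrightarrow> rows = rows'"
proof
  assume eq: "tableau_of_rows rows = tableau_of_rows rows'"
  have lengths: "length rows = length rows'"
    using assms map_eq_imp_length_eq by blast
  moreover have "length (rows ! r) = length (rows' ! r)" if "r < length rows" for r
    using assms lengths that by (metis nth_map)
  moreover from calculation have "rows ! r ! c = rows' ! r ! c"
    if "r < length rows" "c < length (rows ! r)" for r c
    using fun_cong[OF eq, of "(r, c)"] that by (simp add: tableau_of_rows_def)
  ultimately show "rows = rows'"
    by (auto intro!: nth_equalityI)
qed simp

text \<open>
  In between 112/234 and 123/344, exactly four entries can grow, each by one. The flags tell which
  of them have grown, row by row.
\<close>

definition raised :: "bool \<Rightarrow> bool \<Rightarrow> bool \<Rightarrow> bool \<Rightarrow> tableau" where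
  "raised a b c d =
     tableau_of_rows [[1, 1 + of_bool a, 2 + of_bool b], [2 + of_bool c, 3 + of_bool d, 4]]"

abbreviation bottom_tableau :: tableau where
  "bottom_tableau \<equiv> raised False False False False"

abbreviation top_tableau :: tableau where
  "top_tableau \<equiv> raised True True True True"

lemma raised_inject:
  "raised a b c d = raised a' b' c' d' \<longleftrightarrow> a = a' \<and> b = b' \<and> c = c' \<and> d = d'"
  by (auto simp: raised_def tableau_of_rows_inject)

lemma diagram_3_3: "(r, c) \<in> diagram [3, 3] \<longleftrightarrow> (r = 0 \<or> r = 1) \<and> (c = 0 \<or> c = 1 \<or> c = 2)"
  by (auto simp: diagram_def less_Suc_eq)

lemma raised_entries:
  "raised a b c d (0, 0) = 1" "raised a b c d (0, Suc 0) = 1 + of_bool a"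
  "raised a b c d (0, 2) = 2 + of_bool b" "raised a b c d (Suc 0, 0) = 2 + of_bool c"
  "raised a b c d (Suc 0, Suc 0) = 3 + of_bool d" "raised a b c d (Suc 0, 2) = 4"
  by (simp_all add: raised_def tableau_of_rows_apply)

lemma raised_ssyt: "raised a b c d \<in> ssyt 4 [3, 3]"
proof (rule ssytI)
  fix r k r' k'
  show "raised a b c d (r, k) = 0" if "(r, k) \<notin> diagram [3, 3]"
    using that by (auto simp: diagram_3_3 raised_def tableau_of_rows_apply less_Suc_eq)
  show "0 < raised a b c d (r, k) \<and> raised a b c d (r, k) \<le> 4" if "(r, k) \<in> diagram [3, 3]"
    using that unfolding diagram_3_3
    by (elim conjE disjE) (simp_all add: raised_entries of_bool_def)
  show "raised a b c d (r, k) \<le> raised a b c d (r, k')"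
    if "k < k'" "(r, k) \<in> diagram [3, 3]" "(r, k') \<in> diagram [3, 3]"
    using that unfolding diagram_3_3
    by (elim conjE disjE) (simp_all add: raised_entries of_bool_def)
  show "raised a b c d (r, k) < raised a b c d (r', k)"
    if "r < r'" "(r, k) \<in> diagram [3, 3]" "(r', k) \<in> diagram [3, 3]"
    using that unfolding diagram_3_3
    by (elim conjE disjE) (simp_all add: raised_entries of_bool_def)
qed

lemma bottom_le_raised: "bottom_tableau \<le> raised a b c d"
  by (auto simp: le_fun_def raised_def tableau_of_rows_def less_Suc_eq)

lemma between_raised:
  assumes "bottom_tableau \<le> T" "T \<le> top_tableau"
  shows "T = raised (T (0, 1) = 2) (T (0, 2) = 3) (T (1, 0) = 3) (T (1, 1) = 4)"
proof
  fix x
  have le: "bottom_tableau x \<le> T x" "T x \<le> top_tableau x"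
    using assms by (auto dest: le_funD)
  show "T x = raised (T (0, 1) = 2) (T (0, 2) = 3) (T (1, 0) = 3) (T (1, 1) = 4) x"
  proof (cases "x \<in> diagram [3, 3]")
    case True
    then obtain r c where x: "x = (r, c)" and rc: "r = 0 \<or> r = 1" "c = 0 \<or> c = 1 \<or> c = 2"
      by (cases x) (auto simp: diagram_3_3)
    show ?thesis
      using rc le unfolding x by (elim disjE) (auto simp: raised_entries)
  next
    case False
    then show ?thesis
      using le by (simp add: ssyt_outside[OF raised_ssyt])
  qed
qed

lemma reading_cells_3_3: "reading_cells [3, 3] = [(1, 0), (0, 0), (1, 1), (0, 1), (1, 2), (0, 2)]"
  by (simp add: reading_cells_def diagram_def upt_rec)

lemma crystal_f_raised_iff:
  "crystal_f [3, 3] 1 (raised a b c d) = Some (raised a' b' c' d') \<longleftrightarrow>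
     \<not> a \<and> a' \<and> b' = b \<and> c' = c \<and> d' = d"
  "crystal_f [3, 3] 2 (raised a b c d) = Some (raised a' b' c' d') \<longleftrightarrow>
     \<not> b \<and> b' \<and> a' = a \<and> c' = c \<and> d' = d \<and> (\<not> c \<and> d \<or> a \<and> c = d) \<or>
     \<not> c \<and> c' \<and> a' = a \<and> b' = b \<and> d' = d \<and> (if d then \<not> a \<and> b else a \<longrightarrow> b)"
  "crystal_f [3, 3] 3 (raised a b c d) = Some (raised a' b' c' d') \<longleftrightarrow>
     \<not> d \<and> d' \<and> a' = a \<and> b' = b \<and> c' = c"
  unfolding raised_def
  by (cases a; cases b; cases c; cases d;
      simp add: crystal_f_plus_cells plus_cells_def signature_def reading_cells_3_3 cancel_def
        tableau_of_rows_apply tableau_of_rows_update tableau_of_rows_inject)+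

lemma crystal_step_raised_iff:
  "(raised a b c d, raised a' b' c' d') \<in> crystal_step 4 [3, 3] \<longleftrightarrow>
     \<not> a \<and> a' \<and> b' = b \<and> c' = c \<and> d' = d \<or>
     \<not> b \<and> b' \<and> a' = a \<and> c' = c \<and> d' = d \<and> (\<not> c \<and> d \<or> a \<and> c = d) \<or>
     \<not> c \<and> c' \<and> a' = a \<and> b' = b \<and> d' = d \<and> (if d then \<not> a \<and> b else a \<longrightarrow> b) \<or>
     \<not> d \<and> d' \<and> a' = a \<and> b' = b \<and> c' = c"
proof -
  have "{1..<4} = {1, 2, 3 :: nat}" by auto
  then have "(raised a b c d, raised a' b' c' d') \<in> crystal_step 4 [3, 3] \<longleftrightarrow>
      (\<exists>i\<in>{1, 2, 3}. crystal_f [3, 3] i (raised a b c d) = Some (raised a' b' c' d'))"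
    using raised_ssyt by (simp only: crystal_step_def) blast
  then show ?thesis
    by (simp only: crystal_f_raised_iff bex_simps simp_thms disj_assoc)
qed

lemma raised_step_imp_order:
  "(raised a b c d, raised a' b' c' d') \<in> crystal_step 4 [3, 3] \<Longrightarrow>
   (raised a b c d, raised a' b' c' d') \<in> crystal_order 4 [3, 3]"
  by (rule crystal_step_imp_order[OF _ raised_ssyt])

lemma raised_order_induct [consumes 3, case_names step]:
  assumes "(raised a b c d, raised a' b' c' d') \<in> crystal_order 4 [3, 3]"
    and below_top: "(raised a' b' c' d', top_tableau) \<in> crystal_order 4 [3, 3]"
    and "P a b c d"
    and "\<And>a b c d a' b' c' d'. (raised a b c d, raised a' b' c' d') \<in> crystal_step 4 [3, 3] \<Longrightarrow>
      (raised a' b' c' d', top_tableau) \<in> crystal_order 4 [3, 3] \<Longrightarrow> P a b c d \<Longrightarrow> P a' b' c' d'"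
  shows "P a' b' c' d'"
proof -
  have "\<exists>x y z w. raised a' b' c' d' = raised x y z w \<and> P x y z w"
    using assms(1)
  proof (induction rule: crystal_order_induct)
    case base
    show ?case
      using \<open>P a b c d\<close> by blast
  next
    case (step X Y)
    then obtain x y z w where X: "X = raised x y z w" "P x y z w" by blast
    have Y_top: "(Y, top_tableau) \<in> crystal_order 4 [3, 3]"
      using step.hyps(3) below_top by (rule crystal_order_trans)
    have "(X, Y) \<in> crystal_order 4 [3, 3]"
      using step.hyps by (intro crystal_step_imp_order) (auto simp: crystal_order_def)
    then have "bottom_tableau \<le> Y"
      using X(1) bottom_le_raised crystal_order_le order_trans by metis
    then obtain x' y' z' w' where Y: "Y = raised x' y' z' w'"
      using between_raised crystal_order_le[OF Y_top] by blast
    then have "P x' y' z' w'"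
      using assms(4) step.hyps(2) Y_top X by blast
    with Y show ?case by blast
  qed
  then show ?thesis
    by (auto simp: raised_inject)
qed

text \<open>Once \<open>f\<^sub>1\<close> and \<open>f\<^sub>3\<close> have acted, \<open>f\<^sub>2\<close> no longer raises \<open>c\<close>.\<close>

lemma below_top_imp:
  assumes "(raised a b c d, top_tableau) \<in> crystal_order 4 [3, 3]"
  shows "\<not> (a \<and> \<not> c \<and> d)"
proof
  assume "a \<and> \<not> c \<and> d"
  with assms crystal_order_refl[OF raised_ssyt] have "True \<and> \<not> True \<and> True"
    by (rule raised_order_induct[where P = "\<lambda>a b c d. a \<and> \<not> c \<and> d"])
      (auto simp: crystal_step_raised_iff split: if_splits)
  then show False by simp
qed

lemma above_raised_a:
  assumes "(raised True False False False, raised a b c d) \<in> crystal_order 4 [3, 3]"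
    and "(raised a b c d, top_tableau) \<in> crystal_order 4 [3, 3]"
  shows "a \<and> (c \<longrightarrow> b) \<and> (d \<longrightarrow> c)"
  using assms
  by (rule raised_order_induct)
    (auto simp: crystal_step_raised_iff dest: below_top_imp split: if_splits)

lemma above_raised_c:
  assumes "(raised False False True False, raised a b c d) \<in> crystal_order 4 [3, 3]"
    and "(raised a b c d, top_tableau) \<in> crystal_order 4 [3, 3]"
  shows "c \<and> (b \<longrightarrow> a \<and> d)"
  using assms
  by (rule raised_order_induct)
    (auto simp: crystal_step_raised_iff split: if_splits)

lemma above_raised_d:
  assumes "(raised False False False True, raised a b c d) \<in> crystal_order 4 [3, 3]"
    and "(raised a b c d, top_tableau) \<in> crystal_order 4 [3, 3]"
  shows "d \<and> (c \<longrightarrow> b) \<and> (a \<longrightarrow> c)"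
  using assms
  by (rule raised_order_induct)
    (auto simp: crystal_step_raised_iff dest: below_top_imp split: if_splits)

definition atoms :: "tableau set" where
  "atoms =
    {raised True False False False, raised False False True False, raised False False False True}"

lemma bottom_le_atom: "A \<in> atoms \<Longrightarrow> (bottom_tableau, A) \<in> crystal_order 4 [3, 3]"
  by (auto simp: atoms_def crystal_step_raised_iff intro!: raised_step_imp_order)

lemma atom_le_top:
  assumes "A \<in> atoms"
  shows "(A, top_tableau) \<in> crystal_order 4 [3, 3]"
proof -
  let ?r = "crystal_order 4 [3, 3]"
  have "(raised True False False False, raised True True False False) \<in> ?r"
    "(raised True True False False, raised True True True False) \<in> ?r"
    "(raised True True True False, top_tableau) \<in> ?r"
    by (rule raised_step_imp_order, simp add: crystal_step_raised_iff)+
  moreover have "(raised False False True False, raised True False True False) \<in> ?r"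
    "(raised True False True False, raised True False True True) \<in> ?r"
    "(raised True False True True, top_tableau) \<in> ?r"
    by (rule raised_step_imp_order, simp add: crystal_step_raised_iff)+
  moreover have "(raised False False False True, raised False True False True) \<in> ?r"
    "(raised False True False True, raised False True True True) \<in> ?r"
    "(raised False True True True, top_tableau) \<in> ?r"
    by (rule raised_step_imp_order, simp add: crystal_step_raised_iff)+
  ultimately show ?thesis
    using assms crystal_order_trans unfolding atoms_def by blast
qed

lemma bottom_le_top: "(bottom_tableau, top_tableau) \<in> crystal_order 4 [3, 3]"
proof -
  have "raised True False False False \<in> atoms"
    by (simp add: atoms_def)
  then show ?thesis
    using bottom_le_atom atom_le_top crystal_order_trans by blast
qed

lemma ex_atom_below:
  assumes "(bottom_tableau, raised a b c d) \<in> crystal_order 4 [3, 3]"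
    and "(raised a b c d, top_tableau) \<in> crystal_order 4 [3, 3]"
    and "raised a b c d \<noteq> bottom_tableau"
  shows "\<exists>A\<in>atoms. (A, raised a b c d) \<in> crystal_order 4 [3, 3]"
proof -
  define above_atom where
    "above_atom a b c d \<longleftrightarrow> (\<exists>A\<in>atoms. (A, raised a b c d) \<in> crystal_order 4 [3, 3])" for a b c d
  from assms(1,2) have "raised a b c d = bottom_tableau \<or> above_atom a b c d"
  proof (rule raised_order_induct)
    fix a b c d a' b' c' d'
    assume step: "(raised a b c d, raised a' b' c' d') \<in> crystal_step 4 [3, 3]"
    assume "raised a b c d = bottom_tableau \<or> above_atom a b c d"
    then have "above_atom a' b' c' d'"
    proof
      assume "raised a b c d = bottom_tableau"
      then have "raised a' b' c' d' \<in> atoms"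
        using step by (auto simp: raised_inject crystal_step_raised_iff atoms_def)
      then show ?thesis
        using crystal_order_refl[OF raised_ssyt] unfolding above_atom_def by blast
    next
      assume "above_atom a b c d"
      then show ?thesis
        using raised_step_imp_order[OF step] crystal_order_trans unfolding above_atom_def by blast
    qed
    then show "raised a' b' c' d' = bottom_tableau \<or> above_atom a' b' c' d'" ..
  qed simp
  with assms(3) show ?thesis
    by (simp add: above_atom_def)
qed

lemma mobius_bottom_top: "mobius (crystal_order 4 [3, 3]) bottom_tableau top_tableau = 2"
proof -
  let ?r = "crystal_order 4 [3, 3]"
  have "mobius ?r bottom_tableau top_tableau = int (card atoms) - 1"
  proof (rule mobius_disjoint_cones)
    show "atoms \<subseteq> interval ?r bottom_tableau top_tableau - {bottom_tableau, top_tableau}"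
    proof
      fix A assume A: "A \<in> atoms"
      then have "A \<noteq> bottom_tableau \<and> A \<noteq> top_tableau"
        by (auto simp: atoms_def raised_inject)
      then show "A \<in> interval ?r bottom_tableau top_tableau - {bottom_tableau, top_tableau}"
        using bottom_le_atom[OF A] atom_le_top[OF A] by (simp add: interval_def)
    qed
    fix Z assume "Z \<in> interval ?r bottom_tableau top_tableau - {bottom_tableau, top_tableau}"
    then have Z: "(bottom_tableau, Z) \<in> ?r" "(Z, top_tableau) \<in> ?r"
      "Z \<noteq> bottom_tableau" "Z \<noteq> top_tableau"
      by (auto simp: interval_def)
    then obtain a b c d where raised: "Z = raised a b c d"
      using between_raised[OF crystal_order_le[OF Z(1)] crystal_order_le[OF Z(2)]] by blast
    then have "\<exists>A\<in>atoms. (A, Z) \<in> ?r"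
      using ex_atom_below Z by blast
    moreover have "A = B" if "A \<in> atoms" "B \<in> atoms" "(A, Z) \<in> ?r" "(B, Z) \<in> ?r" for A B
      using that above_raised_a[of a b c d] above_raised_c[of a b c d]
        above_raised_d[of a b c d] Z(2,4)
      by (auto simp: raised atoms_def raised_inject)
    ultimately show "\<exists>!A. A \<in> atoms \<and> (A, Z) \<in> ?r" by blast
  qed (simp_all add: bottom_le_top Partial_order_crystal_order finite_interval_crystal_order
      raised_inject)
  moreover have "card atoms = 3"
    by (simp add: atoms_def raised_inject)
  ultimately show ?thesis by simp
qed

lemma ex_mobius_power_2:
  "\<exists>n m u v. 2 \<le> n \<and> (u, v) \<in> crystal_order n (replicate m 3) \<and>
     mobius (crystal_order n (replicate m 3)) u v = 2 ^ k"
proof (induction k)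
  case 0
  let ?r = "crystal_order 2 (replicate 0 3)" and ?empty = "\<lambda>_. 0"
  have "(?empty, ?empty) \<in> ?r"
    by (simp add: crystal_order_refl ssyt_def diagram_def)
  moreover from this have "mobius ?r ?empty ?empty = 1"
    by (simp add: mobius.simps Partial_order_crystal_order finite_interval_crystal_order)
  ultimately show ?case
    by (intro exI[of _ 2] exI[of _ 0] exI[of _ ?empty]) simp
next
  case (Suc k)
  then obtain n m u v where IH: "2 \<le> n" "(u, v) \<in> crystal_order n (replicate m 3)"
    "mobius (crystal_order n (replicate m 3)) u v = 2 ^ k"
    by blast
  have shape: "replicate (2 + m) 3 = [3, 3] @ replicate m (3 :: nat)"
    by (simp add: numeral_2_eq_2)
  have "mobius (crystal_order (4 + n) (replicate (2 + m) 3))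
      (stack [3, 3] 4 bottom_tableau u) (stack [3, 3] 4 top_tableau v) = 2 ^ Suc k"
    unfolding shape mobius_stack[OF bottom_le_top IH(2)] by (simp add: mobius_bottom_top IH(3))
  moreover have "(stack [3, 3] 4 bottom_tableau u, stack [3, 3] 4 top_tableau v)
      \<in> crystal_order (4 + n) (replicate (2 + m) 3)"
    unfolding shape using bottom_le_top IH(2)
    by (subst crystal_order_stack_iff) (auto simp: crystal_order_def)
  ultimately show ?case
    using trans_le_add2[OF IH(1)] by blast
qed

theorem theorem7p3:
  fixes N :: int
  shows "\<exists>n lam u v. 2 \<le> n \<and> is_partition lam \<and> u \<in> ssyt n lam \<and> v \<in> ssyt n lam \<and>
           (u, v) \<in> crystal_order n lam \<and> mobius (crystal_order n lam) u v \<ge> N"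
proof -
  obtain n m u v where uv: "2 \<le> n" "(u, v) \<in> crystal_order n (replicate m 3)"
    "mobius (crystal_order n (replicate m 3)) u v = 2 ^ nat N"
    using ex_mobius_power_2 by blast
  have "N \<le> int (nat N)" by simp
  also have "\<dots> \<le> int (2 ^ nat N)"
    using less_exp[of "nat N"] by (intro of_nat_mono less_imp_le)
  finally have "N \<le> mobius (crystal_order n (replicate m 3)) u v"
    using uv(3) by simp
  moreover have "is_partition (replicate m 3)"
    by (simp add: is_partition_def sorted_wrt_iff_nth_less)
  moreover have "u \<in> ssyt n (replicate m 3)" "v \<in> ssyt n (replicate m 3)"
    using uv(2) by (auto simp: crystal_order_def)
  ultimately show ?thesis
    using uv by blast
qed

end
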